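(* Let $d$ be the Riemannian distance on $SO(3)$ associated with the Riemannian metric induced by the embedding $SO(3)\hookrightarrow\mathbb R^9$, and let $x_0\in SO(3)$. Then the kernel $$K(x,y)=\tfrac12\bigl(d(x,x_0)+d(y,x_0)-d(x,y)\bigr),\qquad x,y\in SO(3),$$ is not positive definite on $SO(3)$.
   Context: $SO(3)$ is the group of $3\times3$ real rotation matrices, viewed as a submanifold of the space of $3\times 3$ real matrices $\cong\mathbb R^9$ with the Euclidean metric; $d$ is the geodesic distance of the induced metric. It is bi-invariant, and up to a multiplicative constant $d(g,e)$ is the rotation angle in $[0,\pi]$ of $g$. A kernel $K$ on a set $X$ is positive definite if $\sum_{i,j}K(x_i,x_j)\xi_i\overline{\xi_j}\ge0$ for all finite families $x_i\in X$, $\xi_i\in\mathbb C$. *)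

theory Defs
  imports "HOL-Analysis.Analysis" "HOL-Library.Complex_Order"
begin

definition SO3 :: "(real^3^3) set" where
  "SO3 = {A. rotation_matrix A}"

text \<open>
  Piecewise \<open>C\<^sup>1\<close> curves of finite length lying in a submanifold \<open>M\<close>. The library's
  \<^const>\<open>valid_path\<close> allows the velocity to be unbounded near a break point; such a curve may
  have infinite length, and its \<^const>\<open>integral\<close> below would then be \<open>0\<close> by convention.
  Integrability of the speed excludes exactly these curves.
\<close>

definition admissible_curves :: "'a::euclidean_space set \<Rightarrow> 'a \<Rightarrow> 'a \<Rightarrow> (real \<Rightarrow> 'a) set" where
  "admissible_curves M x y =
     {\<gamma>. valid_path \<gamma> \<and> path_image \<gamma> \<subseteq> M \<and> pathstart \<gamma> = x \<and> pathfinish \<gamma> = y \<and>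
        (\<lambda>t. norm (vector_derivative \<gamma> (at t))) integrable_on {0..1}}"

definition curve_length :: "(real \<Rightarrow> 'a::euclidean_space) \<Rightarrow> real" where
  "curve_length \<gamma> = integral {0..1} (\<lambda>t. norm (vector_derivative \<gamma> (at t)))"

text \<open>
  The Riemannian distance of the metric induced on \<open>M\<close> by the ambient inner product; meaningful
  for points joined by an admissible curve. On \<^typ>\<open>real^3^3\<close> the library's inner product is the
  entrywise (Frobenius) one, i.e. the Euclidean inner product of \<open>\<real>\<^sup>9\<close>.
\<close>

definition induced_riemannian_dist :: "'a::euclidean_space set \<Rightarrow> 'a \<Rightarrow> 'a \<Rightarrow> real" where
  "induced_riemannian_dist M x y = Inf (curve_length ` admissible_curves M x y)"

text \<open>In the complex order of the library, \<open>0 \<le> z\<close> means that \<open>z\<close> is real and nonnegative.\<close>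

definition positive_definite_kernel_on :: "'a set \<Rightarrow> ('a \<Rightarrow> 'a \<Rightarrow> complex) \<Rightarrow> bool" where
  "positive_definite_kernel_on X K \<longleftrightarrow>
     (\<forall>(n::nat) (x :: nat \<Rightarrow> 'a) (\<xi> :: nat \<Rightarrow> complex). (\<forall>i<n. x i \<in> X) \<longrightarrow>
        0 \<le> (\<Sum>i<n. \<Sum>j<n. K (x i) (x j) * \<xi> i * cnj (\<xi> j)))"

end

theory Submission
  imports Defs
begin

text \<open>
  The kernel fails to be positive definite as soon as there are points \<open>x\<^sub>i\<close> and real weights \<open>\<xi>\<^sub>i\<close> of
  sum zero with \<open>\<Sum>d(x\<^sub>i, x\<^sub>j) \<xi>\<^sub>i \<xi>\<^sub>j > 0\<close>, since the terms with \<open>x\<^sub>0\<close> cancel. Take the Klein four-group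
  \<open>V\<close> of diagonal rotations with weights \<open>1\<close> and its coset \<open>V P\<close>, \<open>P\<close> a cyclic permutation matrix, with
  weights \<open>-1\<close>. Distinct points of the same coset differ by a rotation by \<open>\<pi>\<close>, points of different
  cosets by a rotation by \<open>2\<pi>/3\<close>, so in units of \<open>\<surd>2 \<pi>\<close> the sum is \<open>24 - 32 \<sqdot> 2/3 > 0\<close>.

  Only one inequality is needed for each pair. The upper bound for \<open>2\<pi>/3\<close> comes from an explicit
  one-parameter family of rotations. For the lower bound \<open>\<surd>2 \<pi>\<close>, two rows of the matrix change sign
  along the curve, so each of them runs through a curve of length at least \<open>\<pi>\<close> on the unit
  sphere, and the speed of the curve is at least \<open>1/\<surd>2\<close> times the sum of the speeds of two rows.
\<close>

section \<open>Lower bound for the length of curves in SO(3)\<close>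

text \<open>Only the component of \<open>u\<close> orthogonal to \<open>v\<close> contributes to
  \<open>w \<bullet> u\<close>; its norm is the square root.\<close>

lemma abs_inner_tangent_le:
  fixes v w u :: "'a::real_inner"
  assumes "norm v = 1" "norm u = 1" "v \<bullet> w = 0"
  shows "\<bar>w \<bullet> u\<bar> \<le> norm w * sqrt (1 - (v \<bullet> u)\<^sup>2)"
proof -
  have eq: "w \<bullet> u = w \<bullet> (u - (v \<bullet> u) *\<^sub>R v)"
    using assms(3) by (simp add: inner_diff_right inner_commute)
  have "v \<bullet> v = 1" "u \<bullet> u = 1"
    using assms by (simp_all add: dot_square_norm)
  then have "norm (u - (v \<bullet> u) *\<^sub>R v) = sqrt (1 - (v \<bullet> u)\<^sup>2)"
    by (simp add: norm_eq_sqrt_inner inner_diff_left inner_diff_right inner_commute power2_eq_square)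
  with eq Cauchy_Schwarz_ineq2[of w "u - (v \<bullet> u) *\<^sub>R v"] show ?thesis
    by simp
qed

text \<open>The left side is the rate of change of \<open>arcsin (c * (v \<bullet> u))\<close> when
  \<open>v\<close> moves on the unit sphere with velocity \<open>w\<close>. The preceding bound
  gives the claim because
  \<open>c\<^sup>2 * (1 - x\<^sup>2) \<le> 1 - (c * x)\<^sup>2\<close>.\<close>

lemma abs_deriv_arcsin_le:
  fixes v w u :: "'a::real_inner"
  assumes "norm v = 1" "norm u = 1" "v \<bullet> w = 0" "0 \<le> c" "c < 1"
  shows "\<bar>c * (w \<bullet> u) / sqrt (1 - (c * (v \<bullet> u))\<^sup>2)\<bar> \<le> norm w"
proof -
  let ?x = "v \<bullet> u"
  have x: "?x\<^sup>2 \<le> 1"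
    using Cauchy_Schwarz_ineq2[of v u] assms by (simp add: abs_square_le_1)
  have c2: "c\<^sup>2 < 1"
    using assms by (simp add: power_less_one_iff abs_square_less_1)
  have "(c * ?x)\<^sup>2 \<le> c\<^sup>2 * 1"
    unfolding power_mult_distrib using x by (intro mult_left_mono) auto
  with c2 have pos: "0 < 1 - (c * ?x)\<^sup>2"
    by simp
  have "c\<^sup>2 * (1 - ?x\<^sup>2) \<le> 1 - (c * ?x)\<^sup>2"
    using c2 by (simp add: power_mult_distrib algebra_simps)
  then have "sqrt (c\<^sup>2 * (1 - ?x\<^sup>2)) \<le> sqrt (1 - (c * ?x)\<^sup>2)"
    by (rule real_sqrt_le_mono)
  then have s: "c * sqrt (1 - ?x\<^sup>2) \<le> sqrt (1 - (c * ?x)\<^sup>2)"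
    using assms by (simp add: real_sqrt_mult)
  have "\<bar>c * (w \<bullet> u)\<bar> \<le> c * (norm w * sqrt (1 - ?x\<^sup>2))"
    using abs_inner_tangent_le[OF assms(1-3)] assms(4) by (simp add: abs_mult mult_left_mono)
  also have "\<dots> = norm w * (c * sqrt (1 - ?x\<^sup>2))"
    by simp
  also have "\<dots> \<le> norm w * sqrt (1 - (c * ?x)\<^sup>2)"
    by (intro mult_left_mono s) simp
  finally show ?thesis
    using pos by (simp add: divide_le_eq abs_divide)
qed

lemma row_SO3:
  assumes "A \<in> SO3" shows "norm (A $ i) = 1"
proof -
  have "norm (row i A) = 1"
    using assms by (simp add: SO3_def rotation_matrix_def orthogonal_matrix_orthonormal_rows)
  then show ?thesis by (simp add: row_def)
qed

text \<open>Cauchy-Schwarz for two terms, since the squared Frobenius norm is the sum of the squared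
  norms of the rows.\<close>

lemma norm_rows_le:
  fixes W :: "real^3^3"
  assumes "p \<noteq> q"
  shows "norm (W $ p) + norm (W $ q) \<le> sqrt 2 * norm W"
proof -
  have "(norm (W $ p))\<^sup>2 + (norm (W $ q))\<^sup>2 = (\<Sum>i\<in>{p,q}. (norm (W $ i))\<^sup>2)"
    using assms by simp
  also have "\<dots> \<le> (\<Sum>i\<in>UNIV. (norm (W $ i))\<^sup>2)"
    by (intro sum_mono2) auto
  also have "\<dots> = (norm W)\<^sup>2"
    by (simp add: norm_vec_def L2_set_def sum_nonneg)
  finally have *: "(norm (W $ p))\<^sup>2 + (norm (W $ q))\<^sup>2 \<le> (norm W)\<^sup>2" .
  have "(norm (W $ p) + norm (W $ q))\<^sup>2 \<le> 2 * ((norm (W $ p))\<^sup>2 + (norm (W $ q))\<^sup>2)"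
    using zero_le_power2[of "norm (W $ p) - norm (W $ q)"]
    by (simp add: power2_eq_square algebra_simps)
  also have "\<dots> \<le> (sqrt 2 * norm W)\<^sup>2"
    using * by (simp add: power_mult_distrib)
  finally show ?thesis
    by (rule power2_le_imp_le) simp
qed

text \<open>
  The factor \<open>c < 1\<close> keeps \<open>arcsin\<close> away from \<open>\<plusminus>1\<close>, where it is not differentiable; \<open>c \<rightarrow> 1\<close> gives the
  sharp bound.
\<close>

lemma curve_length_ge_arcsin:
  assumes g: "\<gamma> \<in> admissible_curves SO3 A B"
    and pq: "p \<noteq> q" and Bp: "B $ p = - A $ p" and Bq: "B $ q = - A $ q"
    and c: "0 \<le> c" "c < 1"
  shows "4 * arcsin c \<le> sqrt 2 * curve_length \<gamma>"
proof -
  have vp: "\<gamma> piecewise_C1_differentiable_on {0..1}" and im: "path_image \<gamma> \<subseteq> SO3"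
    and st: "\<gamma> 0 = A" "\<gamma> 1 = B"
    and int: "(\<lambda>t. norm (vector_derivative \<gamma> (at t))) integrable_on {0..1}"
    using g by (auto simp: admissible_curves_def valid_path_def pathstart_def pathfinish_def)
  have in_SO3: "\<gamma> t \<in> SO3" if "t \<in> {0..1}" for t
    using im that by (auto simp: path_image_def)
  have A: "A \<in> SO3"
    using in_SO3[of 0] st by simp
  from vp obtain S where S: "finite S" and C1: "\<gamma> C1_differentiable_on ({0..1} - S)"
    and cont: "continuous_on {0..1} \<gamma>"
    by (auto simp: piecewise_C1_differentiable_on_def)
  let ?V = "\<lambda>t. vector_derivative \<gamma> (at t)"
  have der: "(\<gamma> has_vector_derivative ?V t) (at t)" if "t \<in> {0..1} - S" for t
    using C1 that by (simp add: C1_differentiable_on_eq vector_derivative_works)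
  have der_row: "((\<lambda>t. \<gamma> t $ i) has_vector_derivative ?V t $ i) (at t)" if "t \<in> {0..1} - S" for t i
    using bounded_linear.has_vector_derivative[OF bounded_linear_vec_nth der[OF that]] .
  have bd: "\<bar>c * (\<gamma> t $ i \<bullet> A $ i)\<bar> < 1" if "t \<in> {0..1}" for t i
  proof -
    have "\<bar>\<gamma> t $ i \<bullet> A $ i\<bar> \<le> 1"
      using Cauchy_Schwarz_ineq2[of "\<gamma> t $ i" "A $ i"] row_SO3[OF A] row_SO3[OF in_SO3[OF that]]
      by simp
    then have "c * \<bar>\<gamma> t $ i \<bullet> A $ i\<bar> \<le> c * 1"
      using c by (intro mult_left_mono) auto
    with c show ?thesis by (simp add: abs_mult)
  qed
  \<comment> \<open>For the rows \<open>p\<close> and \<open>q\<close>, which change sign,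
    \<open>G\<close> goes from \<open>arcsin c\<close> to \<open>- arcsin c\<close>, at a rate
    bounded by the speed of the row.\<close>
  define G where "G = (\<lambda>i t. arcsin (c * (\<gamma> t $ i \<bullet> A $ i)))"
  define G' where "G' = (\<lambda>i t. c * (?V t $ i \<bullet> A $ i) / sqrt (1 - (c * (\<gamma> t $ i \<bullet> A $ i))\<^sup>2))"
  have G_der: "(G i has_vector_derivative G' i t) (at t)" if t: "t \<in> {0..1} - S" for t i
  proof -
    have "((\<lambda>t. \<gamma> t $ i \<bullet> A $ i) has_vector_derivative ?V t $ i \<bullet> A $ i) (at t)"
      using bounded_linear.has_vector_derivative[OF bounded_linear_inner_left der_row[OF t]] .
    then have "((\<lambda>t. \<gamma> t $ i \<bullet> A $ i) has_real_derivative ?V t $ i \<bullet> A $ i) (at t)"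
      by (simp add: has_real_derivative_iff_has_vector_derivative)
    then have "(G i has_real_derivative G' i t) (at t)"
      unfolding G_def G'_def using bd[of t i] t
      by (auto intro!: derivative_eq_intros simp: divide_simps abs_less_iff)
    then show ?thesis
      by (simp add: has_real_derivative_iff_has_vector_derivative)
  qed
  \<comment> \<open>Differentiating the constant squared norm of a row needs a neighbourhood in
    which the curve lies in \<open>SO3\<close>, hence an interior point.\<close>
  have tangent: "\<gamma> t $ i \<bullet> ?V t $ i = 0" if t: "t \<in> {0<..<1} - S" for t i
  proof -
    have d: "((\<lambda>t. \<gamma> t $ i) has_derivative (\<lambda>h. h *\<^sub>R (?V t $ i))) (at t)"
      using der_row[of t i] t by (auto simp: has_vector_derivative_def)
    have "((\<lambda>t. \<gamma> t $ i \<bullet> \<gamma> t $ i) has_real_derivative 2 * (\<gamma> t $ i \<bullet> ?V t $ i)) (at t)"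
      unfolding has_field_derivative_def
      by (rule has_derivative_eq_rhs[OF has_derivative_inner[OF d d]])
        (auto simp: inner_commute fun_eq_iff)
    moreover have "eventually (\<lambda>s. \<gamma> s $ i \<bullet> \<gamma> s $ i = 1) (nhds t)"
    proof (rule eventually_nhds_in_open[of "{0<..<1}" t, THEN eventually_mono])
      show "\<gamma> s $ i \<bullet> \<gamma> s $ i = 1" if "s \<in> {0<..<1}" for s
        using row_SO3[OF in_SO3[of s], of i] that by (simp add: dot_square_norm)
    qed (use t in auto)
    ultimately have "((\<lambda>t. 1) has_real_derivative 2 * (\<gamma> t $ i \<bullet> ?V t $ i)) (at t)"
      by (subst (asm) DERIV_cong_ev[OF refl _ refl])
    then have "2 * (\<gamma> t $ i \<bullet> ?V t $ i) = 0"
      by (rule DERIV_unique[OF _ DERIV_const])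
    then show ?thesis
      by simp
  qed
  have G'_le: "\<bar>G' i t\<bar> \<le> norm (?V t $ i)" if t: "t \<in> {0<..<1} - S" for t i
    unfolding G'_def using t
    by (intro abs_deriv_arcsin_le tangent c row_SO3 A in_SO3) auto
  \<comment> \<open>Setting the integrand to 0 at the endpoints and break points, a finite set,
    keeps the integral and lets the comparison of integrands hold at every \<open>t\<close>.\<close>
  let ?F = "\<lambda>t. if t \<in> {0<..<1} - S then - (G' p t + G' q t) else 0"
  have cont_G: "continuous_on {0..1} (G i)" for i
    unfolding G_def using bd
    by (intro continuous_intros cont) (auto simp: abs_less_iff intro: less_imp_le)
  have "((\<lambda>t. - (G' p t + G' q t)) has_integral - (G p 1 + G q 1) - - (G p 0 + G q 0)) {0..1}"
  proof (rule fundamental_theorem_of_calculus_interior_strong[OF S])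
    show "((\<lambda>t. - (G p t + G q t)) has_vector_derivative - (G' p t + G' q t)) (at t)"
      if "t \<in> {0<..<1} - S" for t
      using that by (auto intro!: derivative_intros G_der)
  qed (auto intro!: continuous_intros cont_G)
  moreover have ends: "G i 0 = arcsin c" for i
    using row_SO3[OF A, of i] by (simp add: G_def st dot_square_norm)
  moreover have "G p 1 = - arcsin c" "G q 1 = - arcsin c"
    using row_SO3[OF A] c by (simp_all add: G_def st Bp Bq dot_square_norm arcsin_minus)
  ultimately have "((\<lambda>t. - (G' p t + G' q t)) has_integral 4 * arcsin c) {0..1}"
    by simp
  then have F: "(?F has_integral 4 * arcsin c) {0..1}"
    by (rule has_integral_spike_finite[rotated 2, where S = "insert 0 (insert 1 S)"])
      (use S in auto)
  have "((\<lambda>t. sqrt 2 * norm (?V t)) has_integral sqrt 2 * curve_length \<gamma>) {0..1}"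
    unfolding curve_length_def using int by (intro has_integral_mult_right integrable_integral)
  with F show ?thesis
  proof (rule has_integral_le)
    show "?F t \<le> sqrt 2 * norm (?V t)" for t
      using G'_le[of t p] G'_le[of t q] norm_rows_le[OF pq, of "?V t"] by auto
  qed
qed

text \<open>With \<open>c = sin a\<close> the previous bound reads
  \<open>4 * a \<le> sqrt 2 * curve_length \<gamma>\<close>, and \<open>a\<close> can be taken
  arbitrarily close to \<open>pi / 2\<close>.\<close>

lemma curve_length_ge:
  assumes "\<gamma> \<in> admissible_curves SO3 A B"
    and "p \<noteq> q" "B $ p = - A $ p" "B $ q = - A $ q"
  shows "sqrt 2 * pi \<le> curve_length \<gamma>"
proof (rule ccontr)
  assume "\<not> ?thesis"
  then have "sqrt 2 * curve_length \<gamma> < sqrt 2 * (sqrt 2 * pi)"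
    by (intro mult_strict_left_mono) auto
  also have "sqrt 2 * (sqrt 2 * pi) = 2 * pi"
    by (simp flip: mult.assoc)
  finally have lt: "sqrt 2 * curve_length \<gamma> / 4 < pi / 2"
    by linarith
  have *: "a \<le> sqrt 2 * curve_length \<gamma> / 4" if "0 \<le> a" "a < pi / 2" for a
  proof -
    have "sin a < 1"
      using sin_monotone_2pi[of a "pi / 2"] that pi_gt_zero by simp
    moreover have "0 \<le> sin a"
      using that by (intro sin_ge_zero) auto
    ultimately show ?thesis
      using curve_length_ge_arcsin[OF assms, of "sin a"] that by (simp add: arcsin_sin)
  qed
  have "max 0 (sqrt 2 * curve_length \<gamma> / 4) < pi / 2"
    using lt pi_half_gt_zero by (metis max_less_iff_conj)
  then obtain a where "max 0 (sqrt 2 * curve_length \<gamma> / 4) < a" "a < pi / 2"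
    using dense by blast
  with *[of a] show False by auto
qed

section \<open>One-parameter groups of rotations\<close>

text \<open>Rodrigues' formula: for a unit vector \<open>u\<close>, the rotation by \<open>t\<close>
  about \<open>u\<close>. The last matrix is that of the cross product with
  \<open>u\<close>.\<close>

definition rodrigues :: "real^3 \<Rightarrow> real \<Rightarrow> real^3^3" where
  "rodrigues u t =
     (\<chi> i j. u $ i * u $ j) + cos t *\<^sub>R (mat 1 - (\<chi> i j. u $ i * u $ j))
     + sin t *\<^sub>R vector [vector [0, - u $ 3, u $ 2], vector [u $ 3, 0, - u $ 1], vector [- u $ 2, u $ 1, 0]]"

lemma norm_3_sq: "(norm (u :: real^3))\<^sup>2 = u $ 1 * u $ 1 + u $ 2 * u $ 2 + u $ 3 * u $ 3"
  by (simp add: power2_norm_eq_inner inner_vec_def sum_3)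

text \<open>With N = u u^T and K the cross product matrix, this follows from K^T = -K, K N = N K =
  0, N^2 = |u|^2 N and K^2 = N - |u|^2. For unit \<open>u\<close> the coefficient of N
  vanishes.\<close>

lemma transpose_rodrigues_mult:
  "transpose (rodrigues u t) ** rodrigues u t =
     ((cos t)\<^sup>2 + (sin t)\<^sup>2 * (norm u)\<^sup>2) *\<^sub>R mat 1
     + (2 * cos t * (1 - cos t) + (1 - cos t)\<^sup>2 * (norm u)\<^sup>2 - (sin t)\<^sup>2) *\<^sub>R (\<chi> i j. u $ i * u $ j)"
  unfolding norm_3_sq rodrigues_def
  by (simp add: vec_eq_iff forall_3 matrix_matrix_mult_def transpose_def mat_def sum_3)
    (intro conjI; algebra)

text \<open>Expanded form of (cos t + (1 - cos t) |u|^2) (cos^2 t + sin^2 t |u|^2): the factor on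
  the axis times the determinant on the plane orthogonal to it.\<close>

lemma det_rodrigues:
  "det (rodrigues u t) =
     (cos t) ^ 3 + cos t * (sin t)\<^sup>2 * (norm u)\<^sup>2
     + (1 - cos t) * ((cos t)\<^sup>2 * (norm u)\<^sup>2 + (sin t)\<^sup>2 * (norm u) ^ 4)"
proof -
  have "(norm u) ^ 4 = ((norm u)\<^sup>2)\<^sup>2"
    by simp
  then show ?thesis
    unfolding norm_3_sq rodrigues_def
    by (simp add: det_3 mat_def) (simp add: power2_eq_square power3_eq_cube algebra_simps)
qed

lemma rodrigues_in_SO3:
  assumes "norm u = 1"
  shows "rodrigues u t \<in> SO3"
proof -
  have "2 * cos t * (1 - cos t) + (1 - cos t)\<^sup>2 - (sin t)\<^sup>2 = 0"
    using sin_cos_squared_add[of t] by algebra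
  then have "transpose (rodrigues u t) ** rodrigues u t = mat 1"
    using assms by (simp add: transpose_rodrigues_mult)
  moreover have "det (rodrigues u t) = 1"
  proof -
    have "cos t ^ 3 + cos t * (sin t)\<^sup>2 + (1 - cos t) * ((cos t)\<^sup>2 + (sin t)\<^sup>2) = 1"
      using sin_cos_squared_add[of t] by algebra
    then show ?thesis
      using assms by (simp add: det_rodrigues)
  qed
  ultimately show ?thesis
    by (simp add: SO3_def rotation_matrix_def orthogonal_matrix)
qed

lemma rodrigues_0: "rodrigues u 0 = mat 1"
  by (simp add: rodrigues_def)

definition rodrigues' :: "real^3 \<Rightarrow> real \<Rightarrow> real^3^3" where
  "rodrigues' u t =
     - sin t *\<^sub>R (mat 1 - (\<chi> i j. u $ i * u $ j))
     + cos t *\<^sub>R vector [vector [0, - u $ 3, u $ 2], vector [u $ 3, 0, - u $ 1], vector [- u $ 2, u $ 1, 0]]"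

lemma rodrigues_has_vector_derivative:
  "((\<lambda>t. rodrigues u (t * \<theta>)) has_vector_derivative \<theta> *\<^sub>R rodrigues' u (t * \<theta>)) (at t)"
  unfolding rodrigues_def rodrigues'_def
  by (auto intro!: derivative_eq_intros simp: algebra_simps)

lemma continuous_rodrigues': "continuous_on S (\<lambda>t. rodrigues' u (t * \<theta>))"
  unfolding rodrigues'_def by (intro continuous_intros)

text \<open>The sine part is symmetric and the cosine part skew, so they are orthogonal; for unit
  \<open>u\<close> both matrices have norm \<open>sqrt 2\<close> before scaling.\<close>

lemma norm_rodrigues':
  assumes "norm u = 1"
  shows "norm (rodrigues' u t) = sqrt 2"
proof -
  have "rodrigues' u t \<bullet> rodrigues' u t = (sin t)\<^sup>2 * (3 - 2 * (norm u)\<^sup>2 + ((norm u)\<^sup>2)\<^sup>2) + 2 * (cos t)\<^sup>2 * (norm u)\<^sup>2"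
    unfolding norm_3_sq rodrigues'_def
    by (simp add: inner_vec_def mat_def sum_3) algebra
  then have "rodrigues' u t \<bullet> rodrigues' u t = 2"
    using assms distrib_left[of 2 "(sin t)\<^sup>2" "(cos t)\<^sup>2", symmetric] by (simp add: mult.commute)
  then show ?thesis
    by (simp add: norm_eq_sqrt_inner)
qed

text \<open>Each row of \<open>W\<close> is moved by the orthogonal map \<open>transpose A\<close>.
  This is the right invariance of the metric.\<close>

lemma norm_matrix_mult_SO3:
  assumes "A \<in> SO3"
  shows "norm (W ** A) = norm W"
proof -
  have AT: "orthogonal_matrix (transpose A)"
    using assms by (simp add: SO3_def rotation_matrix_def)
  have "(W ** A) $ i = transpose A *v (W $ i)" for i
    by (simp add: vec_eq_iff matrix_matrix_mult_def matrix_vector_mult_def transpose_def mult.commute)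
  moreover have "norm (transpose A *v w) = norm w" for w
    using AT orthogonal_transformation_matrix[of "(*v) (transpose A)"]
    by (simp add: orthogonal_transformation_norm del: transpose_matrix_vector orthogonal_matrix_transpose)
  ultimately show ?thesis
    by (simp add: norm_vec_def)
qed

lemma bounded_linear_matrix_mult_right: "bounded_linear (\<lambda>X. X ** (A :: real^3^3) :: real^3^3)"
  by (intro linear_conv_bounded_linear[THEN iffD1] linearI)
    (simp_all add: vec_eq_iff matrix_matrix_mult_def sum_distrib_left sum.distrib algebra_simps)

lemma SO3_mult: "A \<in> SO3 \<Longrightarrow> B \<in> SO3 \<Longrightarrow> A ** B \<in> SO3"
  by (simp add: SO3_def rotation_matrix_def orthogonal_matrix_mul det_mul)

text \<open>By right invariance, the translate by \<open>A\<close> has the same constant speed as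
  the one-parameter group itself.\<close>

lemma rodrigues_curve:
  assumes u: "norm u = 1" and A: "A \<in> SO3" and "0 \<le> \<theta>"
  defines "\<gamma> \<equiv> \<lambda>t. rodrigues u (t * \<theta>) ** A"
  shows "\<gamma> \<in> admissible_curves SO3 A (rodrigues u \<theta> ** A)"
    and "curve_length \<gamma> = sqrt 2 * \<theta>"
proof -
  have der: "(\<gamma> has_vector_derivative \<theta> *\<^sub>R rodrigues' u (t * \<theta>) ** A) (at t)" for t
    unfolding \<gamma>_def
    using bounded_linear.has_vector_derivative[OF bounded_linear_matrix_mult_right
        rodrigues_has_vector_derivative] .
  have "\<gamma> C1_differentiable_on {0..1}"
    unfolding C1_differentiable_on_def
    by (intro exI[of _ "\<lambda>t. \<theta> *\<^sub>R rodrigues' u (t * \<theta>) ** A"] conjI ballI der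
        bounded_linear.continuous_on[OF bounded_linear_matrix_mult_right] continuous_intros
        continuous_rodrigues')
  then have "valid_path \<gamma>"
    by (simp add: valid_path_def C1_differentiable_imp_piecewise)
  moreover have speed: "norm (vector_derivative \<gamma> (at t)) = sqrt 2 * \<theta>" for t
    using vector_derivative_at[OF der, of t] assms
    by (simp add: norm_matrix_mult_SO3 norm_rodrigues')
  ultimately show "\<gamma> \<in> admissible_curves SO3 A (rodrigues u \<theta> ** A)"
    using assms by (auto simp: admissible_curves_def path_image_def pathstart_def pathfinish_def
        rodrigues_0 integrable_const_ivl intro!: SO3_mult rodrigues_in_SO3)
  show "curve_length \<gamma> = sqrt 2 * \<theta>"
    unfolding curve_length_def speed by simp
qed

section \<open>Kernels and weights of sum zero\<close>

text \<open>The terms with \<open>x\<^sub>0\<close> depend on one summation index only, so their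
  double sums contain the factor \<open>\<Sum>i<n. \<xi> i\<close>. What remains is -1/2 times the
  sum in \<open>pos\<close>.\<close>

lemma not_positive_definite_kernel_onI:
  fixes d :: "'a \<Rightarrow> 'a \<Rightarrow> real" and \<xi> :: "nat \<Rightarrow> real"
  assumes x: "\<And>i. i < n \<Longrightarrow> x i \<in> X"
    and \<xi>: "(\<Sum>i<n. \<xi> i) = 0"
    and pos: "(\<Sum>i<n. \<Sum>j<n. d (x i) (x j) * \<xi> i * \<xi> j) > 0"
  shows "\<not> positive_definite_kernel_on X
           (\<lambda>x y. complex_of_real (1 / 2 * (d x x\<^sub>0 + d y x\<^sub>0 - d x y)))"
    (is "\<not> positive_definite_kernel_on X (\<lambda>x y. complex_of_real (?K x y))")
proof
  assume "positive_definite_kernel_on X (\<lambda>x y. complex_of_real (?K x y))"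
  then have "0 \<le> (\<Sum>i<n. \<Sum>j<n. complex_of_real (?K (x i) (x j)) * of_real (\<xi> i) * cnj (of_real (\<xi> j)))"
    using x unfolding positive_definite_kernel_on_def
    by (elim allE[of _ n] allE[of _ x] allE[of _ "\<lambda>i. complex_of_real (\<xi> i)"] impE) blast+
  also have "\<dots> = complex_of_real (\<Sum>i<n. \<Sum>j<n. ?K (x i) (x j) * \<xi> i * \<xi> j)"
    by simp
  finally have "0 \<le> (\<Sum>i<n. \<Sum>j<n. ?K (x i) (x j) * \<xi> i * \<xi> j)"
    by (simp only: less_eq_complex_def Re_complex_of_real zero_complex.sel)
  also have "\<dots> = 1 / 2 * ((\<Sum>i<n. \<Sum>j<n. (d (x i) x\<^sub>0 * \<xi> i) * \<xi> j)
      + (\<Sum>i<n. \<Sum>j<n. \<xi> i * (d (x j) x\<^sub>0 * \<xi> j))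
      - (\<Sum>i<n. \<Sum>j<n. d (x i) (x j) * \<xi> i * \<xi> j))"
    unfolding sum_distrib_left sum_subtractf[symmetric] sum.distrib[symmetric]
    by (intro sum.cong refl) (simp add: algebra_simps)
  also have "\<dots> = - 1 / 2 * (\<Sum>i<n. \<Sum>j<n. d (x i) (x j) * \<xi> i * \<xi> j)"
    by (simp flip: sum_product add: \<xi>)
  finally show False
    using pos by simp
qed

section \<open>Bounds for the distance as an infimum\<close>

lemma curve_length_nonneg:
  "\<gamma> \<in> admissible_curves M x y \<Longrightarrow> 0 \<le> curve_length \<gamma>"
  by (auto simp: admissible_curves_def curve_length_def intro: integral_nonneg)

lemma induced_riemannian_dist_le:
  "\<gamma> \<in> admissible_curves M x y \<Longrightarrow> induced_riemannian_dist M x y \<le> curve_length \<gamma>"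
  unfolding induced_riemannian_dist_def
  by (intro cInf_lower bdd_belowI2[of _ 0] curve_length_nonneg) auto

text \<open>A common lower bound passes to the infimum of a nonempty set; the first assumption
  supplies an element.\<close>

lemma induced_riemannian_dist_ge:
  assumes "\<gamma> \<in> admissible_curves M x y"
    and "\<And>\<gamma>. \<gamma> \<in> admissible_curves M x y \<Longrightarrow> c \<le> curve_length \<gamma>"
  shows "c \<le> induced_riemannian_dist M x y"
  unfolding induced_riemannian_dist_def using assms by (intro cInf_greatest) auto

lemma dist_rodrigues_le:
  assumes "norm u = 1" "A \<in> SO3" "0 \<le> \<theta>" "rodrigues u \<theta> ** A = B"
  shows "induced_riemannian_dist SO3 A B \<le> sqrt 2 * \<theta>"
  using induced_riemannian_dist_le[OF rodrigues_curve(1)[OF assms(1-3)]]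
    rodrigues_curve(2)[OF assms(1-3)] assms(4) by simp

text \<open>Diagonal terms enter the final sum with positive weight, so a lower bound is wanted.
  Rotation by the angle 0 shows that there is a curve.\<close>

lemma dist_refl_nonneg:
  assumes "A \<in> SO3"
  shows "0 \<le> induced_riemannian_dist SO3 A A"
  using rodrigues_curve(1)[of "axis 1 1" A 0] assms
  by (intro induced_riemannian_dist_ge curve_length_nonneg) (auto simp: rodrigues_0)

section \<open>The Klein four-group and its coset\<close>

text \<open>The diagonals of the elements of the Klein four-group; the product condition is
  determinant 1.\<close>

definition sign_vector :: "real^3 \<Rightarrow> bool" where
  "sign_vector s \<longleftrightarrow> (\<forall>i. s $ i = 1 \<or> s $ i = - 1) \<and> s $ 1 * s $ 2 * s $ 3 = 1"

lemma sign_vector_cases: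
  assumes "sign_vector s"
  shows "s $ 1 = 1 \<and> s $ 2 = 1 \<and> s $ 3 = 1 \<or> s $ 1 = 1 \<and> s $ 2 = - 1 \<and> s $ 3 = - 1 \<or>
    s $ 1 = - 1 \<and> s $ 2 = 1 \<and> s $ 3 = - 1 \<or> s $ 1 = - 1 \<and> s $ 2 = - 1 \<and> s $ 3 = 1"
  using assms unfolding sign_vector_def forall_3 by (elim conjE disjE) simp_all

definition sign_matrix :: "real^3 \<Rightarrow> real^3^3" where
  "sign_matrix s = (\<chi> i j. if i = j then s $ i else 0)"

text \<open>A rotation by 2 pi / 3 about a line through (1, 1, 1).\<close>

definition cyclic_matrix :: "real^3^3" where
  "cyclic_matrix = vector [vector [0, 1, 0], vector [0, 0, 1], vector [1, 0, 0]]"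

lemma sign_matrix_in_SO3: "sign_vector s \<Longrightarrow> sign_matrix s \<in> SO3"
  by (auto simp: sign_vector_def sign_matrix_def SO3_def rotation_matrix_def orthogonal_matrix
      det_3 vec_eq_iff forall_3 matrix_matrix_mult_def transpose_def mat_def sum_3)

lemma cyclic_matrix_in_SO3: "cyclic_matrix \<in> SO3"
  by (simp add: cyclic_matrix_def SO3_def rotation_matrix_def orthogonal_matrix
      det_3 vec_eq_iff forall_3 matrix_matrix_mult_def transpose_def mat_def sum_3)

lemma sign_matrix_mult_row: "(sign_matrix s ** Q) $ i = s $ i *\<^sub>R Q $ i"
  using exhaust_3[of i] by (auto simp: vec_eq_iff sign_matrix_def matrix_matrix_mult_def sum_3)

lemma rodrigues_pi: "rodrigues u pi = 2 *\<^sub>R (\<chi> i j. u $ i * u $ j) - mat 1"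
  by (simp add: rodrigues_def scaleR_2)

lemma dist_sign_matrix_ge:
  assumes s: "sign_vector s" and t: "sign_vector t" and "s \<noteq> t" and Q: "Q \<in> SO3"
  shows "sqrt 2 * pi \<le> induced_riemannian_dist SO3 (sign_matrix s ** Q) (sign_matrix t ** Q)"
proof -
  \<comment> \<open>The sign changes occur at \<open>p\<close> and \<open>q\<close>, while
    \<open>k\<close> is the coordinate where \<open>s\<close> and \<open>t\<close> agree. The
    half-turn about axis \<open>k\<close> provides a curve, so that the infimum is over a nonempty
    set.\<close>
  obtain p q k where "p \<noteq> q" and neg: "t $ p = - s $ p" "t $ q = - s $ q"
    and rot: "rodrigues (axis k 1) pi ** sign_matrix s = sign_matrix t"
  proof -
    have rot: "rodrigues (axis k 1) pi ** sign_matrix s = sign_matrix t"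
      if "\<And>i. t $ i = (if i = k then s $ i else - s $ i)" for k
      using exhaust_3[of k] unfolding rodrigues_pi sign_matrix_def
      by (auto simp: vec_eq_iff forall_3 matrix_matrix_mult_def mat_def sum_3 axis_def that)
    consider "\<forall>i. t $ i = (if i = 1 then s $ i else - s $ i)"
      | "\<forall>i. t $ i = (if i = 2 then s $ i else - s $ i)"
      | "\<forall>i. t $ i = (if i = 3 then s $ i else - s $ i)"
      using sign_vector_cases[OF s] sign_vector_cases[OF t] \<open>s \<noteq> t\<close>
      unfolding vec_eq_iff forall_3 by (elim disjE conjE) simp_all
    then show thesis
      by cases (use that[of 2 3 1] that[of 1 3 2] that[of 1 2 3] rot in auto)
  qed
  have A: "sign_matrix s ** Q \<in> SO3"
    by (intro SO3_mult sign_matrix_in_SO3 s Q)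
  have "norm (axis k 1 :: real^3) = 1"
    by simp
  from rodrigues_curve(1)[OF this A, of pi]
  have "\<exists>\<gamma>. \<gamma> \<in> admissible_curves SO3 (sign_matrix s ** Q) (sign_matrix t ** Q)"
    by (auto simp: matrix_mul_assoc rot)
  then show ?thesis
    using \<open>p \<noteq> q\<close> neg
    by (auto intro!: induced_riemannian_dist_ge intro: curve_length_ge simp: sign_matrix_mult_row)
qed

text \<open>The axes are the diagonals of a cube. The value -1/2 of the cosine cancels the diagonal
  entries, and the factors \<open>sqrt 3\<close> of axis and sine cancel.\<close>

lemma rodrigues_120:
  fixes w :: "real^3"
  assumes "\<And>i. w $ i = 1 \<or> w $ i = - 1"
  shows "norm ((1 / sqrt 3) *\<^sub>R w) = 1"
    and "rodrigues ((1 / sqrt 3) *\<^sub>R w) (2 * pi / 3) =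
      (1 / 2) *\<^sub>R vector [vector [0, w $ 1 * w $ 2 - w $ 3, w $ 1 * w $ 3 + w $ 2],
                      vector [w $ 1 * w $ 2 + w $ 3, 0, w $ 2 * w $ 3 - w $ 1],
                      vector [w $ 1 * w $ 3 - w $ 2, w $ 2 * w $ 3 + w $ 1, 0]]"
proof -
  have sq: "w $ i * w $ i = 1" for i
    using assms[of i] by auto
  have "(norm w)\<^sup>2 = 3"
    by (simp add: norm_3_sq sq)
  then have "norm w = sqrt 3"
    by (metis norm_ge_zero real_sqrt_unique)
  then show "norm ((1 / sqrt 3) *\<^sub>R w) = 1"
    by simp
  show "rodrigues ((1 / sqrt 3) *\<^sub>R w) (2 * pi / 3) =
      (1 / 2) *\<^sub>R vector [vector [0, w $ 1 * w $ 2 - w $ 3, w $ 1 * w $ 3 + w $ 2],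
                      vector [w $ 1 * w $ 2 + w $ 3, 0, w $ 2 * w $ 3 - w $ 1],
                      vector [w $ 1 * w $ 3 - w $ 2, w $ 2 * w $ 3 + w $ 1, 0]]"
    unfolding rodrigues_def cos_120 sin_120
    by (simp add: vec_eq_iff forall_3 mat_def sq field_simps)
qed

lemma dist_cyclic_matrix_le:
  assumes s: "sign_vector s" and t: "sign_vector t"
  shows "induced_riemannian_dist SO3 (sign_matrix s) (sign_matrix t ** cyclic_matrix)
           \<le> sqrt 2 * (2 * pi / 3)"
    and "induced_riemannian_dist SO3 (sign_matrix t ** cyclic_matrix) (sign_matrix s)
           \<le> sqrt 2 * (2 * pi / 3)"
proof -
  \<comment> \<open>The product \<open>sign_matrix t ** cyclic_matrix ** sign_matrix s\<close> has
    its nonzero entries t2 s3, t3 s1, t1 s2 at (2,3), (3,1), (1,2); its skew part gives the axis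
    \<open>- ?w\<close>. The inverse rotation, about \<open>?w\<close>, yields the second
    bound.\<close>
  let ?w = "vector [t $ 2 * s $ 3, t $ 3 * s $ 1, t $ 1 * s $ 2] :: real^3"
  note st = sign_vector_cases[OF s] sign_vector_cases[OF t]
  have "\<forall>i. ?w $ i = 1 \<or> ?w $ i = - 1" "\<forall>i. (- ?w) $ i = 1 \<or> (- ?w) $ i = - 1"
    unfolding forall_3 using st by (elim disjE conjE; simp)+
  then have w: "\<And>i. ?w $ i = 1 \<or> ?w $ i = - 1" "\<And>i. (- ?w) $ i = 1 \<or> (- ?w) $ i = - 1"
    by blast+
  note simps = vec_eq_iff forall_3 matrix_matrix_mult_def sign_matrix_def cyclic_matrix_def sum_3
  have "rodrigues ((1 / sqrt 3) *\<^sub>R (- ?w)) (2 * pi / 3) ** sign_matrix s = sign_matrix t ** cyclic_matrix"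
    unfolding rodrigues_120(2)[OF w(2)] using st by (elim disjE conjE) (simp_all add: simps)
  then show "induced_riemannian_dist SO3 (sign_matrix s) (sign_matrix t ** cyclic_matrix)
      \<le> sqrt 2 * (2 * pi / 3)"
    by (intro dist_rodrigues_le[OF rodrigues_120(1)[OF w(2)]] sign_matrix_in_SO3 s) auto
  have "rodrigues ((1 / sqrt 3) *\<^sub>R ?w) (2 * pi / 3) ** (sign_matrix t ** cyclic_matrix) = sign_matrix s"
    unfolding rodrigues_120(2)[OF w(1)] using st by (elim disjE conjE) (simp_all add: simps)
  then show "induced_riemannian_dist SO3 (sign_matrix t ** cyclic_matrix) (sign_matrix s)
      \<le> sqrt 2 * (2 * pi / 3)"
    by (intro dist_rodrigues_le[OF rodrigues_120(1)[OF w(1)]] SO3_mult sign_matrix_in_SO3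
        cyclic_matrix_in_SO3 t) auto
qed

section \<open>The eight points and their weights\<close>

definition sign_vec :: "nat \<Rightarrow> real^3" where
  "sign_vec k = (if k = 0 then vector [1, 1, 1] else if k = 1 then vector [1, - 1, - 1]
     else if k = 2 then vector [- 1, 1, - 1] else vector [- 1, - 1, 1])"

lemma sign_vector_sign_vec: "sign_vector (sign_vec k)"
  by (simp add: sign_vector_def sign_vec_def forall_3)

lemma sign_vec_inj: "k < 4 \<Longrightarrow> l < 4 \<Longrightarrow> sign_vec k = sign_vec l \<Longrightarrow> k = l"
  by (auto simp: sign_vec_def vec_eq_iff forall_3 split: if_splits)

theorem proposition0p0p4:
  fixes x\<^sub>0 :: "real^3^3" and d :: "real^3^3 \<Rightarrow> real^3^3 \<Rightarrow> real"
  assumes "x\<^sub>0 \<in> SO3"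
    and "d = induced_riemannian_dist SO3"
  shows "\<not> positive_definite_kernel_on SO3
           (\<lambda>x y. complex_of_real (1 / 2 * (d x x\<^sub>0 + d y x\<^sub>0 - d x y)))"
proof -
  define Q where "Q = (\<lambda>i :: nat. if i < 4 then mat 1 else cyclic_matrix)"
  define x where "x = (\<lambda>i. sign_matrix (sign_vec (i mod 4)) ** Q i)"
  define \<xi> where "\<xi> = (\<lambda>i :: nat. if i < 4 then 1 else - 1 :: real)"
  \<comment> \<open>In units of \<open>sqrt 2 * pi\<close>, these are lower bounds for the weighted
    distances. Across the cosets the weight is -1, which turns the upper bound 2/3 into
    -2/3.\<close>
  define w where "w = (\<lambda>i j :: nat. if i = j then 0 else if (i < 4) = (j < 4) then 1 else - (2 / 3) :: real)"
  have "mat 1 \<in> SO3"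
    by (simp add: SO3_def rotation_matrix_def orthogonal_matrix_id)
  then have Q: "Q i \<in> SO3" for i
    using cyclic_matrix_in_SO3 by (simp add: Q_def)
  then have x: "x i \<in> SO3" for i
    unfolding x_def by (intro SO3_mult sign_matrix_in_SO3 sign_vector_sign_vec)
  have term_ge: "sqrt 2 * pi * w i j \<le> d (x i) (x j) * \<xi> i * \<xi> j"
    if ij: "i < 8" "j < 8" for i j :: nat
  proof (cases "(i < 4) = (j < 4)")
    case True
    then have same: "Q i = Q j" "\<xi> i * \<xi> j = 1"
      by (auto simp: Q_def \<xi>_def)
    show ?thesis
    proof (cases "i = j")
      case True
      then show ?thesis
        using dist_refl_nonneg[OF x] same assms(2) by (simp add: w_def mult.assoc)
    next
      case False
      moreover have "k mod 4 = (if k < 4 then k else k - 4)" if "k < 8" for k :: nat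
        using that by (simp add: mod_if)
      ultimately have "i mod 4 \<noteq> j mod 4"
        using True ij by (auto split: if_splits)
      then have "sign_vec (i mod 4) \<noteq> sign_vec (j mod 4)"
        using sign_vec_inj by (metis mod_less_divisor zero_less_numeral)
      then show ?thesis
        using dist_sign_matrix_ge[OF sign_vector_sign_vec sign_vector_sign_vec _ Q, of "i mod 4" "j mod 4" j]
          same assms(2) True False by (simp add: w_def x_def mult.assoc)
    qed
  next
    case False
    have "d (x i) (x j) \<le> sqrt 2 * (2 * pi / 3)"
    proof (cases "i < 4")
      case True
      with False show ?thesis
        using dist_cyclic_matrix_le(1)[OF sign_vector_sign_vec sign_vector_sign_vec]
        by (simp add: x_def Q_def assms(2))
    next
      case False': False
      with False show ?thesis
        using dist_cyclic_matrix_le(2)[OF sign_vector_sign_vec sign_vector_sign_vec]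
        by (simp add: x_def Q_def assms(2))
    qed
    moreover have "\<xi> i * \<xi> j = - 1" "w i j = - (2 / 3)"
      using False by (auto simp: \<xi>_def w_def)
    ultimately show ?thesis
      by (simp add: mult.assoc)
  qed
  \<comment> \<open>There are 24 ordered pairs of distinct indices within a coset and 32 across: 24
    - 64/3 = 8/3.\<close>
  have "(\<Sum>i<8. \<Sum>j<8. w i j) = 8 / 3"
    by (simp add: w_def eval_nat_numeral)
  then have "0 < (\<Sum>i<8. \<Sum>j<8. sqrt 2 * pi * w i j)"
    by (simp flip: sum_distrib_left)
  also have "\<dots> \<le> (\<Sum>i<8. \<Sum>j<8. d (x i) (x j) * \<xi> i * \<xi> j)"
    by (intro sum_mono term_ge) auto
  finally show ?thesis
    using x by (intro not_positive_definite_kernel_onI[where n = 8 and x = x and \<xi> = \<xi>])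
      (auto simp: \<xi>_def eval_nat_numeral)
qed

end
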